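(* Let $F_2=\langle a,b\mid\varnothing\rangle$ be the free group on two generators, $B_1=\{e_{F_2},a,b,a^{-1},b^{-1}\}$, and let $$X_{+}=\Big\{x\in(\mathbb{Z}/2\mathbb{Z})^{F_2}:\ \sum_{s\in B_1}x(gs)=0\text{ for every }g\in F_2\Big\}$$ with the left shift action of $F_2$. Then $X_{+}$ has no off-diagonal asymptotic pairs; that is, if $(x,y)\in X_{+}\times X_{+}$ is an asymptotic pair, then $x=y$.
   Context: The left shift action is $(gx)(h)=x(g^{-1}h)$, and $(\mathbb{Z}/2\mathbb{Z})^{F_2}$ has the product topology, with $d$ a compatible metric on $X_+$. A pair $(x,y)$ is asymptotic if for every $\varepsilon>0$ there is a finite $F\subset F_2$ with $d(gx,gy)\le\varepsilon$ for all $g\notin F$ (equivalently, for this subshift, $x(g)=y(g)$ for all but finitely many $g\in F_2$). *)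

theory Defs
  imports "HOL-Analysis.Analysis" "HOL-Library.Z2"
begin

text \<open>
  The free group on two generators is realised as the type of freely reduced words. A letter
  is a generator together with a sign: \<open>(s, True)\<close> stands for \<open>s\<close>, \<open>(s, False)\<close> for its inverse.
\<close>

datatype generator = Gen_a | Gen_b

type_synonym letter = "generator \<times> bool"

definition inv_letter :: "letter \<Rightarrow> letter" where
  "inv_letter u = (fst u, \<not> snd u)"

definition reduced_word :: "letter list \<Rightarrow> bool" where
  "reduced_word w \<longleftrightarrow> successively (\<lambda>u v. v \<noteq> inv_letter u) w"

text \<open>\<open>cons_red u w\<close> is the reduced form of \<open>u # w\<close> when \<open>w\<close> is reduced.\<close>

fun cons_red :: "letter \<Rightarrow> letter list \<Rightarrow> letter list" where
  "cons_red u [] = [u]"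
| "cons_red u (v # w) = (if v = inv_letter u then w else u # v # w)"

definition word_mult :: "letter list \<Rightarrow> letter list \<Rightarrow> letter list" where
  "word_mult v w = foldr cons_red v w"

definition word_inv :: "letter list \<Rightarrow> letter list" where
  "word_inv w = rev (map inv_letter w)"

lemma inv_letter_inv_letter [simp]: "inv_letter (inv_letter u) = u"
  by (simp add: inv_letter_def)

lemma inv_letter_neq [simp]: "inv_letter u \<noteq> u" "u \<noteq> inv_letter u"
  by (auto simp: inv_letter_def prod_eq_iff)

lemma reduced_Nil [simp]: "reduced_word []"
  by (simp add: reduced_word_def)

lemma reduced_single [simp]: "reduced_word [u]"
  by (simp add: reduced_word_def)

lemma reduced_Cons_Cons [simp]:
  "reduced_word (u # v # w) \<longleftrightarrow> v \<noteq> inv_letter u \<and> reduced_word (v # w)"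
  by (simp add: reduced_word_def)

lemma reduced_tl: "reduced_word (u # w) \<Longrightarrow> reduced_word w"
  by (cases w) auto

lemma reduced_cons_red: "reduced_word w \<Longrightarrow> reduced_word (cons_red u w)"
  by (cases w) (auto dest: reduced_tl)

lemma reduced_word_mult: "reduced_word w \<Longrightarrow> reduced_word (word_mult v w)"
  unfolding word_mult_def by (induction v) (auto intro: reduced_cons_red)

lemma reduced_word_inv: "reduced_word w \<Longrightarrow> reduced_word (word_inv w)"
proof -
  assume "reduced_word w"
  then have "successively (\<lambda>u v. u \<noteq> inv_letter v) w"
    unfolding reduced_word_def by (rule successively_mono) auto
  then show ?thesis
    unfolding reduced_word_def word_inv_def
    by (auto simp: successively_rev successively_map simp del: split_paired_All
        elim!: successively_mono) (metis inv_letter_inv_letter)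
qed

lemma cons_red_cancel: "reduced_word w \<Longrightarrow> cons_red u (cons_red (inv_letter u) w) = w"
proof (cases w)
  case (Cons v w')
  assume "reduced_word w"
  then show ?thesis using Cons by (cases w') auto
qed simp

lemma cons_red_cancel': "reduced_word w \<Longrightarrow> cons_red (inv_letter u) (cons_red u w) = w"
  using cons_red_cancel [of w "inv_letter u"] by simp

lemma cons_red_reduced: "reduced_word (u # w) \<Longrightarrow> cons_red u w = u # w"
  by (cases w) auto

lemma word_mult_cons_red:
  "reduced_word w \<Longrightarrow> word_mult (cons_red u v) w = cons_red u (word_mult v w)"
proof (cases v)
  case (Cons u' v')
  assume "reduced_word w"
  then show ?thesis
    using Cons cons_red_cancel [OF reduced_word_mult, of w u v']
    by (auto simp: word_mult_def)
qed (simp add: word_mult_def)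

lemma word_mult_assoc:
  "reduced_word w \<Longrightarrow> word_mult (word_mult u v) w = word_mult u (word_mult v w)"
proof (induction u)
  case (Cons l u)
  have "word_mult (word_mult (l # u) v) w = word_mult (cons_red l (word_mult u v)) w"
    by (simp add: word_mult_def)
  also have "\<dots> = cons_red l (word_mult u (word_mult v w))"
    using Cons by (simp add: word_mult_cons_red)
  finally show ?case by (simp add: word_mult_def)
qed (simp add: word_mult_def)

lemma word_mult_Nil_right: "reduced_word w \<Longrightarrow> word_mult w [] = w"
proof (induction w)
  case (Cons u w)
  then have "word_mult (u # w) [] = cons_red u w"
    using reduced_tl [OF Cons.prems] by (simp add: word_mult_def)
  then show ?case using Cons.prems by (simp add: cons_red_reduced)
qed (simp add: word_mult_def)

lemma word_mult_inv_left_aux: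
  "reduced_word v \<Longrightarrow> word_mult (word_inv w) (word_mult w v) = v"
proof (induction w)
  case (Cons u w)
  then show ?case
    by (simp add: word_inv_def word_mult_def cons_red_cancel'
        reduced_word_mult [unfolded word_mult_def])
qed (simp add: word_inv_def word_mult_def)

lemma word_mult_inv_left: "reduced_word w \<Longrightarrow> word_mult (word_inv w) w = []"
  using word_mult_inv_left_aux [of "[]" w] by (simp add: word_mult_Nil_right)

typedef F2 = "{w. reduced_word w}" morphisms word_of F2_of_word
  by (rule exI [of _ "[]"]) simp

setup_lifting type_definition_F2

instantiation F2 :: "{monoid_mult, inverse}"
begin

lift_definition one_F2 :: F2 is "[]" by simp

lift_definition times_F2 :: "F2 \<Rightarrow> F2 \<Rightarrow> F2" is word_mult by (rule reduced_word_mult)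

lift_definition inverse_F2 :: "F2 \<Rightarrow> F2" is word_inv by (rule reduced_word_inv)

definition divide_F2 :: "F2 \<Rightarrow> F2 \<Rightarrow> F2" where
  "divide_F2 g h = g * inverse h"

instance
proof
  fix g h k :: F2
  show "g * h * k = g * (h * k)" by transfer (rule word_mult_assoc)
  show "1 * g = g" by transfer (simp add: word_mult_def)
  show "g * 1 = g" by transfer (rule word_mult_Nil_right)
qed

end

lift_definition F2_letter :: "letter \<Rightarrow> F2" is "\<lambda>u. [u]" by simp

definition gen_a :: F2 where "gen_a = F2_letter (Gen_a, True)"
definition gen_b :: F2 where "gen_b = F2_letter (Gen_b, True)"

lemma F2_left_inverse: "inverse g * g = (1 :: F2)"
  by transfer (rule word_mult_inv_left)

lemma F2_right_inverse: "g * inverse g = (1 :: F2)"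
proof -
  have "inverse (inverse g) = g"
    by transfer (simp add: word_inv_def rev_map o_def)
  then show ?thesis using F2_left_inverse [of "inverse g"] by simp
qed

lemma F2_letter_inv: "F2_letter (inv_letter u) = inverse (F2_letter u)"
  by transfer (simp add: word_inv_def)

lemma F2_word_induct [case_names one letter]:
  assumes "P 1" and "\<And>u g. P g \<Longrightarrow> P (F2_letter u * g)"
  shows "P (g :: F2)"
proof -
  have "reduced_word w \<Longrightarrow> P (F2_of_word w)" for w
  proof (induction w)
    case Nil
    then show ?case using assms(1) by (simp add: one_F2_def)
  next
    case (Cons u w)
    have "F2_of_word (u # w) = F2_letter u * F2_of_word w"
      using Cons.prems reduced_tl [OF Cons.prems]
      by (subst word_of_inject [symmetric])
        (simp add: times_F2.rep_eq F2_letter.rep_eq F2_of_word_inverse word_mult_def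
          cons_red_reduced)
    moreover have "P (F2_of_word w)"
      using Cons.IH reduced_tl [OF Cons.prems] .
    ultimately show ?case using assms(2) by simp
  qed
  then show ?thesis
    using word_of [of g] word_of_inverse [of g] by force
qed

text \<open>
  Universal property of \<open>F2\<close>. The target is a type of class \<open>group_add\<close>, i.e. an arbitrary, not
  necessarily commutative, group written additively.
\<close>

lemma F2_universal_property:
  fixes p q :: "'g :: group_add"
  shows "\<exists>!f. (\<forall>g h :: F2. f (g * h) = f g + f h) \<and> f gen_a = p \<and> f gen_b = q"
proof -
  define val where "val = (\<lambda>u :: letter.
    let r = (case fst u of Gen_a \<Rightarrow> p | Gen_b \<Rightarrow> q) in if snd u then r else - r)"
  define ev where "ev = (\<lambda>w. sum_list (map val w))"
  have val_inv: "val (inv_letter u) = - val u" for u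
    by (simp add: val_def inv_letter_def Let_def)
  have ev_cons: "ev (cons_red u w) = val u + ev w" for u w
    by (cases w) (auto simp: ev_def val_inv)
  have ev_mult: "ev (word_mult v w) = ev v + ev w" for v w
    unfolding word_mult_def by (induction v) (simp_all add: ev_cons, simp_all add: ev_def add.assoc)
  show ?thesis
  proof (rule ex1I [of _ "\<lambda>g. ev (word_of g)"])
    show "(\<forall>g h. ev (word_of (g * h)) = ev (word_of g) + ev (word_of h)) \<and>
      ev (word_of gen_a) = p \<and> ev (word_of gen_b) = q"
      by (simp add: times_F2.rep_eq ev_mult gen_a_def gen_b_def F2_letter.rep_eq)
        (simp add: ev_def val_def)
  next
    fix f :: "F2 \<Rightarrow> 'g"
    assume f: "(\<forall>g h. f (g * h) = f g + f h) \<and> f gen_a = p \<and> f gen_b = q"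
    have f1: "f 1 = 0"
    proof -
      have "f (1 * 1) = f 1 + f 1" using f by blast
      then have "f 1 + f 1 = f 1 + 0" by simp
      then show ?thesis by (rule add_left_imp_eq)
    qed
    have finv: "f (inverse g) = - f g" for g
    proof -
      have "f (inverse g) + f g = 0"
        using f f1 by (simp flip: F2_left_inverse [of g])
      then show ?thesis by (rule eq_neg_iff_add_eq_0 [THEN iffD2])
    qed
    have flet: "f (F2_letter u) = val u" for u
    proof (cases u)
      case (Pair s e)
      have neg: "F2_letter (s, False) = inverse (F2_letter (s, True))" for s
        using F2_letter_inv [of "(s, True)"] by (simp add: inv_letter_def)
      have "f (F2_letter (Gen_a, True)) = p" "f (F2_letter (Gen_b, True)) = q"
        using f by (simp_all add: gen_a_def gen_b_def)
      then show ?thesis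
        unfolding Pair val_def by (cases s; cases e) (simp_all add: neg finv)
    qed
    show "f = (\<lambda>g. ev (word_of g))"
    proof
      fix g
      show "f g = ev (word_of g)"
      proof (induction g rule: F2_word_induct)
        case one
        then show ?case using f1 by (simp add: one_F2.rep_eq ev_def)
      next
        case (letter u g)
        have "f (F2_letter u * g) = val u + ev (word_of g)"
          using f flet letter by simp
        moreover have "ev [u] = val u"
          by (simp add: ev_def)
        ultimately show ?case
          by (simp add: times_F2.rep_eq ev_mult F2_letter.rep_eq)
      qed
    qed
  qed
qed

definition B1 :: "F2 set" where
  "B1 = {1, gen_a, gen_b, inverse gen_a, inverse gen_b}"

lemma card_B1: "card B1 = 5"
proof -
  have "word_of ` B1 = {[], [(Gen_a, True)], [(Gen_b, True)], [(Gen_a, False)], [(Gen_b, False)]}"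
    by (simp add: B1_def gen_a_def gen_b_def one_F2.rep_eq F2_letter.rep_eq inverse_F2.rep_eq
        word_inv_def inv_letter_def)
  moreover have "inj_on word_of B1"
    by (simp add: inj_on_def word_of_inject)
  ultimately have "card B1 = card {[], [(Gen_a, True)], [(Gen_b, True)],
      [(Gen_a, False)], [(Gen_b, False)]}"
    using card_image by metis
  then show ?thesis by simp
qed

definition X_plus :: "(F2 \<Rightarrow> bit) set" where
  "X_plus = {x. \<forall>g. (\<Sum>s\<in>B1. x (g * s)) = 0}"

definition shift :: "F2 \<Rightarrow> (F2 \<Rightarrow> bit) \<Rightarrow> (F2 \<Rightarrow> bit)" where
  "shift g x = (\<lambda>h. x (inverse g * h))"

lemma shift_one: "shift 1 x = x"
  using F2_right_inverse [of 1] by (simp add: shift_def)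

lemma shift_mult: "shift (g * h) x = shift g (shift h x)"
proof -
  have "inverse (g * h) = inverse h * inverse g"
  proof -
    have "inverse h * inverse g * ((g * h) * inverse (g * h)) = inverse (g * h)"
      using F2_left_inverse [of g] F2_left_inverse [of h]
      by (metis mult.assoc mult_1_left)
    then show ?thesis by (simp add: F2_right_inverse)
  qed
  then show ?thesis by (simp add: shift_def mult.assoc)
qed

lemma shift_X_plus: "x \<in> X_plus \<Longrightarrow> shift g x \<in> X_plus"
  by (simp add: X_plus_def shift_def flip: mult.assoc)

definition config_topology :: "(F2 \<Rightarrow> bit) topology" where
  "config_topology = product_topology (\<lambda>_. discrete_topology UNIV) UNIV"

definition compatible_metric ::
  "(F2 \<Rightarrow> bit) set \<Rightarrow> ((F2 \<Rightarrow> bit) \<Rightarrow> (F2 \<Rightarrow> bit) \<Rightarrow> real) \<Rightarrow> bool" where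
  "compatible_metric X d \<longleftrightarrow>
     Metric_space X d \<and> Metric_space.mtopology X d = subtopology config_topology X"

lemma countable_F2: "countable (UNIV :: F2 set)"
proof -
  have "(UNIV :: generator set) = {Gen_a, Gen_b}"
    using generator.exhaust by auto
  then have "countable (UNIV :: generator set)"
    by (metis countable_empty countable_insert)
  then have "countable (UNIV :: letter set)"
    using countable_SIGMA [of "UNIV :: generator set" "\<lambda>_. UNIV :: bool set"] by simp
  then have "countable (UNIV :: letter list set)"
    using countable_lists [of "UNIV :: letter set"] by simp
  moreover have "inj word_of"
    by (simp add: inj_on_def word_of_inject)
  ultimately show ?thesis
    by (meson countable_image_inj_on countable_subset subset_UNIV)
qed

lemma compatible_metric_exists: "\<exists>d. compatible_metric X d"
proof -
  have "metrizable_space config_topology"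
    unfolding config_topology_def metrizable_space_product_topology
    using countable_subset [OF subset_UNIV countable_F2]
    by simp
  then have "metrizable_space (subtopology config_topology X)"
    by (rule metrizable_space_subtopology)
  then obtain M d where M: "Metric_space M d"
    and top: "subtopology config_topology X = Metric_space.mtopology M d"
    unfolding metrizable_space_def by blast
  have "topspace (subtopology config_topology X) = X"
    by (simp add: config_topology_def)
  then have "M = X"
    using M top by (simp add: Metric_space.topspace_mtopology)
  then show ?thesis
    using M top unfolding compatible_metric_def by metis
qed

text \<open>
  Only the values of \<open>d\<close> on the subshift matter when \<open>x\<close> and \<open>y\<close> lie in it, by
  invariance under the shift.
\<close>

definition asymptotic_pair ::
  "((F2 \<Rightarrow> bit) \<Rightarrow> (F2 \<Rightarrow> bit) \<Rightarrow> real) \<Rightarrow> (F2 \<Rightarrow> bit) \<Rightarrow> (F2 \<Rightarrow> bit) \<Rightarrow> bool" where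
  "asymptotic_pair d x y \<longleftrightarrow>
     (\<forall>\<epsilon>>0. \<exists>F. finite F \<and> (\<forall>g. g \<notin> F \<longrightarrow> d (shift g x) (shift g y) \<le> \<epsilon>))"

end

theory Submission
  imports Defs
begin

text \<open>
  By compactness of \<open>X_plus\<close>, an asymptotic pair disagrees on a finite set only, so the difference
  \<open>z\<close> is a finitely supported element of \<open>X_plus\<close>. If \<open>g\<close> were an element of maximal word length
  in the support, choose a letter \<open>t\<close> such that \<open>g t\<close> is reduced. Every neighbour of \<open>g t\<close> other
  than \<open>g\<close>, and \<open>g t\<close> itself, is longer than \<open>g\<close>, so the relation at \<open>g t\<close> reduces to
  \<open>z g = 0\<close>, a contradiction.
\<close>

lemma F2_inverse_inverse: "inverse (inverse g) = (g :: F2)"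
  by transfer (simp add: word_inv_def rev_map o_def)

lemma word_mult_reduced_append: "reduced_word (v @ w) \<Longrightarrow> word_mult v w = v @ w"
proof (induction v)
  case (Cons u v)
  then show ?case
    using reduced_tl [of u "v @ w"] by (simp add: word_mult_def cons_red_reduced)
qed (simp add: word_mult_def)

lemma reduced_snoc:
  "reduced_word (w @ [u]) \<longleftrightarrow> reduced_word w \<and> (w \<noteq> [] \<longrightarrow> u \<noteq> inv_letter (last w))"
  by (auto simp: reduced_word_def successively_append_iff)

text \<open>No cancellation occurs where the words meet, so right multiplication by \<open>u\<close>
  lengthens the word by exactly one letter. This serves both the step from a longest support element
  to its neighbour and the steps onward from there.\<close>

lemma word_of_mult_letter:
  assumes "word_of g = [] \<or> u \<noteq> inv_letter (last (word_of g))"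
  shows "word_of (g * F2_letter u) = word_of g @ [u]"
proof -
  have "reduced_word (word_of g @ [u])"
    using assms word_of [of g] by (auto simp: reduced_snoc)
  then show ?thesis
    by (simp add: times_F2.rep_eq F2_letter.rep_eq word_mult_reduced_append)
qed

text \<open>Puts the four generators and inverses in uniform form, so that one argument about a
  letter \<open>u\<close> covers every neighbour.\<close>

lemma B1_eq: "B1 = insert 1 (range F2_letter)"
proof -
  have "(UNIV :: letter set) = {(Gen_a, True), (Gen_b, True), (Gen_a, False), (Gen_b, False)}"
    by (auto intro: generator.exhaust)
  then have "range F2_letter =
      F2_letter ` {(Gen_a, True), (Gen_b, True), (Gen_a, False), (Gen_b, False)}"
    by (rule arg_cong)
  moreover have "F2_letter (v, False) = inverse (F2_letter (v, True))" for v
    using F2_letter_inv [of "(v, True)"] by (simp add: inv_letter_def)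
  ultimately show ?thesis
    by (simp add: B1_def gen_a_def gen_b_def)
qed

lemma finite_B1: "finite B1"
  by (simp add: B1_def)

lemma X_plus_finite_support:
  assumes z: "z \<in> X_plus" and fin: "finite {g. z g \<noteq> 0}"
  shows "z g = 0"
proof (rule ccontr)
  assume "z g \<noteq> 0"
  define len where "len = (\<lambda>g. length (word_of g))"
  have "Max (len ` {g. z g \<noteq> 0}) \<in> len ` {g. z g \<noteq> 0}"
    using \<open>z g \<noteq> 0\<close> by (intro Max_in finite_imageI fin) blast
  then obtain m where m: "z m \<noteq> 0" and m_max: "len m = Max (len ` {g. z g \<noteq> 0})"
    by (metis (mono_tags, lifting) imageE mem_Collect_eq)
  have long: "z h = 0" if "len m < len h" for h
  proof (rule ccontr)
    assume "z h \<noteq> 0"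
    then have "len h \<le> len m"
      unfolding m_max by (intro Max_ge finite_imageI fin) auto
    with that show False by simp
  qed
  \<comment> \<open>The last letter of \<open>word_of m\<close> itself will do, since no letter is
    its own inverse.\<close>
  obtain t where t: "word_of m = [] \<or> t \<noteq> inv_letter (last (word_of m))"
    using inv_letter_neq by blast
  define h where "h = m * F2_letter t"
  have h: "word_of h = word_of m @ [t]"
    unfolding h_def by (rule word_of_mult_letter [OF t])
  have h_t: "h * F2_letter (inv_letter t) = m"
    by (simp add: h_def F2_letter_inv mult.assoc F2_right_inverse)
  have "z (h * s) = 0" if s: "s \<in> B1" "s \<noteq> F2_letter (inv_letter t)" for s
  proof (rule long)
    consider (one) "s = 1" | (letter) u where "s = F2_letter u" "u \<noteq> inv_letter t"
      using s unfolding B1_eq by blast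
    then show "len m < len (h * s)"
    proof cases
      case one
      then show ?thesis by (simp add: len_def h)
    next
      case letter
      \<comment> \<open>The last letter of \<open>h\<close> is \<open>t\<close>, so \<open>u\<close>
        does not cancel and \<open>h * s\<close> is two letters longer than
        \<open>m\<close>.\<close>
      then show ?thesis using h by (simp add: len_def word_of_mult_letter)
    qed
  qed
  then have "(\<Sum>s\<in>B1. z (h * s)) = (\<Sum>s\<in>{F2_letter (inv_letter t)}. z (h * s))"
    by (intro sum.mono_neutral_right finite_B1) (auto simp: B1_eq)
  moreover have "(\<Sum>s\<in>B1. z (h * s)) = 0"
    using z by (simp add: X_plus_def)
  ultimately show False
    using m h_t by simp
qed

lemma X_plus_diff: "x \<in> X_plus \<Longrightarrow> y \<in> X_plus \<Longrightarrow> (\<lambda>g. x g - y g) \<in> X_plus"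
  unfolding X_plus_def by (simp only: mem_Collect_eq sum_subtractf diff_self simp_thms)

lemma continuous_map_coordinate:
  "continuous_map config_topology (discrete_topology UNIV) (\<lambda>x. x g)"
  unfolding config_topology_def by (rule continuous_map_product_projection) simp

text \<open>A product of two discrete spaces is discrete, so addition is continuous and the claim
  follows by induction on \<open>I\<close>. For infinite \<open>I\<close> the sum is constantly
  0.\<close>

lemma continuous_map_sum_discrete:
  fixes f :: "'i \<Rightarrow> 'a \<Rightarrow> 'b :: comm_monoid_add"
  assumes "\<And>i. i \<in> I \<Longrightarrow> continuous_map T (discrete_topology UNIV) (f i)"
  shows "continuous_map T (discrete_topology UNIV) (\<lambda>x. \<Sum>i\<in>I. f i x)"
  using assms
proof (induction I rule: infinite_finite_induct)
  case (insert i I)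
  have "continuous_map T (discrete_topology (UNIV \<times> UNIV)) (\<lambda>x. (f i x, \<Sum>i\<in>I. f i x))"
    using insert by (simp add: prod_topology_discrete_topology continuous_map_pairedI
        del: UNIV_Times_UNIV)
  moreover have "continuous_map (discrete_topology (UNIV \<times> UNIV)) (discrete_topology UNIV)
      (\<lambda>(a, b). a + b :: 'b)"
    by simp
  ultimately have "continuous_map T (discrete_topology UNIV)
      ((\<lambda>(a, b). a + b) \<circ> (\<lambda>x. (f i x, \<Sum>i\<in>I. f i x)))"
    by (rule continuous_map_compose)
  then show ?case
    using insert.hyps by (simp add: o_def)
qed auto

text \<open>Each relation is the preimage of the closed set \<open>{0}\<close> under a continuous
  sum of coordinates, and \<open>X_plus\<close> is the intersection of these preimages over all
  \<open>g\<close>.\<close>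

lemma closedin_X_plus: "closedin config_topology X_plus"
proof -
  have "closedin config_topology {x \<in> topspace config_topology. (\<Sum>s\<in>B1. x (g * s)) \<in> {0}}" for g
    by (rule closedin_continuous_map_preimage
        [OF continuous_map_sum_discrete [OF continuous_map_coordinate]]) simp
  then have "closedin config_topology (\<Inter>g. {x. (\<Sum>s\<in>B1. x (g * s)) = 0})"
    by (intro closedin_Inter) (auto simp: config_topology_def)
  moreover have "X_plus = (\<Inter>g. {x. (\<Sum>s\<in>B1. x (g * s)) = 0})"
    by (auto simp: X_plus_def)
  ultimately show ?thesis by simp
qed

lemma compact_space_X_plus: "compact_space (subtopology config_topology X_plus)"
proof -
  have "finite (UNIV :: bit set)"
    by (metis (full_types) UNIV_eq_I bit.exhaust finite.emptyI finite.insertI insertI1 insertI2)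
  then have "compact_space config_topology"
    by (simp add: config_topology_def compact_space_product_topology compact_space_discrete_topology)
  then show ?thesis
    using closedin_X_plus closedin_compact_space compact_space_subtopology by blast
qed

text \<open>By Heine-Cantor, reading coordinate \<open>g\<close> is uniformly continuous on the
  compact space \<open>X_plus\<close>. As its values are discrete, a small enough distance forces
  equality.\<close>

lemma compatible_metric_separates_coordinate:
  assumes "compatible_metric X_plus d"
  obtains \<epsilon> where "\<epsilon> > 0"
    "\<And>u v. u \<in> X_plus \<Longrightarrow> v \<in> X_plus \<Longrightarrow> d u v \<le> \<epsilon> \<Longrightarrow> u g = v g"
proof -
  interpret Metric_space X_plus d
    using assms by (simp add: compatible_metric_def)
  have top: "mtopology = subtopology config_topology X_plus"
    using assms by (simp add: compatible_metric_def)
  \<comment> \<open>Encoding the coordinate as a real 0 or 1 puts distinct values at distance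
    exactly 1.\<close>
  define f :: "(F2 \<Rightarrow> bit) \<Rightarrow> real" where "f = (\<lambda>u. of_bool (u g = 0))"
  have "continuous_map config_topology euclidean f"
    using continuous_map_compose [OF continuous_map_coordinate [of g],
        of euclidean "\<lambda>a. of_bool (a = 0)"]
    by (simp add: f_def o_def)
  then have "continuous_map mtopology euclidean f"
    unfolding top by (rule continuous_map_from_subtopology)
  then have "uniformly_continuous_map (metric (X_plus, d)) euclidean_metric f"
    using compact_space_X_plus top
    by (intro continuous_imp_uniformly_continuous_map) simp_all
  then obtain \<delta> where "\<delta> > 0"
    and \<delta>: "\<And>u v. u \<in> X_plus \<Longrightarrow> v \<in> X_plus \<Longrightarrow> d v u < \<delta> \<Longrightarrow> dist (f v) (f u) < 1"
    unfolding uniformly_continuous_map_def by (auto dest!: spec [of _ "1 :: real"])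
  show thesis
  \<comment> \<open>Halving turns the strict bound of uniform continuity into the non-strict one of
    asymptotic pairs.\<close>
  proof (rule that [of "\<delta> / 2"])
    fix u v
    assume uv: "u \<in> X_plus" "v \<in> X_plus" "d u v \<le> \<delta> / 2"
    then have "dist (f u) (f v) < 1"
      using \<open>\<delta> > 0\<close> by (intro \<delta>) auto
    then show "u g = v g"
      by (cases "u g"; cases "v g") (simp_all add: f_def)
  qed (use \<open>\<delta> > 0\<close> in simp)
qed

text \<open>Shifting by \<open>g\<close> brings coordinate \<open>inverse g\<close> to the identity,
  so a single \<epsilon> that controls the identity coordinate handles all but finitely many
  coordinates.\<close>

lemma asymptotic_pair_finite_disagreement:
  assumes d: "compatible_metric X_plus d" and "x \<in> X_plus" "y \<in> X_plus"
    and asym: "asymptotic_pair d x y"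
  shows "finite {g. x g \<noteq> y g}"
proof -
  obtain \<epsilon> where "\<epsilon> > 0"
    and eps: "\<And>u v. u \<in> X_plus \<Longrightarrow> v \<in> X_plus \<Longrightarrow> d u v \<le> \<epsilon> \<Longrightarrow> u 1 = v 1"
    using compatible_metric_separates_coordinate [OF d] by metis
  obtain F where "finite F" and F: "\<And>g. g \<notin> F \<Longrightarrow> d (shift g x) (shift g y) \<le> \<epsilon>"
    using asym \<open>\<epsilon> > 0\<close> unfolding asymptotic_pair_def by blast
  have "x (inverse g) = y (inverse g)" if "g \<notin> F" for g
    using eps [OF shift_X_plus shift_X_plus F [OF that]] assms(2,3)
    by (simp add: shift_def)
  then have "{g. x g \<noteq> y g} \<subseteq> inverse ` F"
    by (metis (mono_tags, lifting) F2_inverse_inverse image_eqI mem_Collect_eq subsetI)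
  then show ?thesis
    using \<open>finite F\<close> finite_surj by blast
qed

theorem proposition7p7:
  fixes d :: "(F2 \<Rightarrow> bit) \<Rightarrow> (F2 \<Rightarrow> bit) \<Rightarrow> real"
    and x y :: "F2 \<Rightarrow> bit"
  assumes "compatible_metric X_plus d"
    and "x \<in> X_plus" and "y \<in> X_plus"
    and "asymptotic_pair d x y"
  shows "x = y"
proof
  fix g
  have "{g. x g - y g \<noteq> 0} = {g. x g \<noteq> y g}"
    by (simp only: right_minus_eq)
  then have "finite {g. x g - y g \<noteq> 0}"
    using asymptotic_pair_finite_disagreement [OF assms] by (simp only:)
  then have "x g - y g = 0"
    by (rule X_plus_finite_support [OF X_plus_diff [OF assms(2,3)]])
  then show "x g = y g"
    by (simp only: right_minus_eq)
qed

end
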